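(* Let $\mathbf{k}=(k_1,\ldots,k_r)$ be any index (a finite, possibly empty, tuple of positive integers) and let $N$ be any positive integer. Then \[\zeta^\star_{<N}(\mathbf{k})=\zeta^{\star\flat}_{<N}(\mathbf{k}),\] where \[\zeta^\star_{<N}(\mathbf{k})=\sum_{0<m_1\le\cdots\le m_r<N}\frac{1}{m_1^{k_1}\cdots m_r^{k_r}}\] and \[\zeta^{\star\flat}_{<N}(\mathbf{k})=\sum\prod_{i=1}^r\frac{1}{(N-n_{i1})\,n_{i2}\cdots n_{ik_i}},\] the latter sum running over all integers $n_{ij}$ ($1\le i\le r$, $1\le j\le k_i$) satisfying $0<n_{i1}\le n_{i2}\le\cdots\le n_{ik_i}<N$ for each $1\le i\le r$ and $n_{(i-1)1}\le n_{ik_i}$ for each $2\le i\le r$.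
   Context: The sums are over integers. For the empty index ($r=0$) both $\zeta^\star_{<N}(\varnothing)$ and $\zeta^{\star\flat}_{<N}(\varnothing)$ are defined to be $1$. *)

theory Defs imports Complex_Main begin

text \<open>
  An index is a list of positive naturals. Lists are indexed from 0, so \<open>ks ! i\<close> is
  $k_{i+1}$, \<open>ms ! i\<close> is $m_{i+1}$ and \<open>nss ! i ! j\<close> is $n_{(i+1)(j+1)}$.
\<close>

definition is_index :: "nat list \<Rightarrow> bool" where
  "is_index ks \<longleftrightarrow> (\<forall>k\<in>set ks. 0 < k)"

definition star_domain :: "nat \<Rightarrow> nat list \<Rightarrow> nat list set" where
  "star_domain N ks =
    {ms. length ms = length ks \<and> (\<forall>m\<in>set ms. 0 < m \<and> m < N) \<and> sorted ms}"

definition zeta_star :: "nat \<Rightarrow> nat list \<Rightarrow> real" where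
  "zeta_star N ks =
    (\<Sum>ms\<in>star_domain N ks. 1 / (\<Prod>i<length ks. real (ms ! i) ^ (ks ! i)))"

definition star_flat_domain :: "nat \<Rightarrow> nat list \<Rightarrow> nat list list set" where
  "star_flat_domain N ks =
    {nss. length nss = length ks \<and>
          (\<forall>i<length ks. length (nss ! i) = ks ! i \<and>
             (\<forall>n\<in>set (nss ! i). 0 < n \<and> n < N) \<and> sorted (nss ! i)) \<and>
          (\<forall>i. 1 \<le> i \<and> i < length ks \<longrightarrow> nss ! (i - 1) ! 0 \<le> nss ! i ! (ks ! i - 1))}"

definition zeta_star_flat :: "nat \<Rightarrow> nat list \<Rightarrow> real" where
  "zeta_star_flat N ks =
    (\<Sum>nss\<in>star_flat_domain N ks.
      \<Prod>i<length ks. 1 / ((real N - real (nss ! i ! 0)) * (\<Prod>j=1..<ks ! i. real (nss ! i ! j))))"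

lemma finite_star_domain: "finite (star_domain N ks)"
proof (rule finite_subset)
  show "star_domain N ks \<subseteq> {ms. set ms \<subseteq> {..<N} \<and> length ms = length ks}"
    by (auto simp: star_domain_def)
qed (simp add: finite_lists_length_eq)

lemma finite_star_flat_domain: "finite (star_flat_domain N ks)"
proof (rule finite_subset)
  let ?R = "{ns. set ns \<subseteq> {..<N} \<and> length ns \<le> sum_list ks}"
  show "star_flat_domain N ks \<subseteq> {nss. set nss \<subseteq> ?R \<and> length nss = length ks}"
    by (force simp: star_flat_domain_def in_set_conv_nth intro: elem_le_sum_list)
  show "finite {nss. set nss \<subseteq> ?R \<and> length nss = length ks}"
    by (intro finite_lists_length_eq finite_lists_length_le) simp
qed

lemma zeta_star_Nil: "zeta_star N [] = 1"
proof -
  have "star_domain N [] = {[]}"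
    by (auto simp: star_domain_def)
  then show ?thesis
    by (simp add: zeta_star_def)
qed

lemma zeta_star_flat_Nil: "zeta_star_flat N [] = 1"
proof -
  have "star_flat_domain N [] = {[]}"
    by (auto simp: star_flat_domain_def)
  then show ?thesis
    by (simp add: zeta_star_flat_def)
qed

end

(* Both sums are iterated sums, read off from the last block with a lower bound l on the first
   summation variable (star_from and flat_from).  On the flat side a block of length k applies
   the averaging operator g |-> (1/n) sum_{i<=n} g(i) exactly k - 1 times.  The connector
     C(n,m) = binom(n-1,m-1) (m-1)! (N-m-1)! / (N-1)!
   is an eigenvector of averaging in n with eigenvalue 1/m, and it intertwines the two remaining
   summations:  sum_{n<=i<N} C(i,m) = (N-n)/m sum_{j<=m} C(n,j).  Hence the flat sum bounded below
   by n is (N-n) sum_m C(n,m) times the star sum bounded below by m, and for n = 1 only m = 1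
   contributes. *)
theory Submission imports Defs begin

section \<open>The connector\<close>

definition conn :: "nat \<Rightarrow> nat \<Rightarrow> nat \<Rightarrow> real" where
  "conn N n m = real ((n - 1) choose (m - 1)) * fact (m - 1) * fact (N - m - 1) / fact (N - 1)"

text \<open>The sum telescopes: with T(m) = binom(n-1,m) m! (N-m-1)!/(N-1)! one has (N-n)
  \<open>conn N n (m+1)\<close> = T(m) - T(m+1) and T(0) = 1.\<close>

lemma sum_conn_second:
  assumes "1 \<le> n" "m < N"
  shows "(real N - real n) * (\<Sum>j=1..m. conn N n j) =
    1 - real ((n - 1) choose m) * fact m * fact (N - m - 1) / fact (N - 1)"
  using assms(2)
proof (induction m)
  case 0
  then show ?case by simp
next
  case (Suc m)
  obtain d where d: "N = Suc (Suc (m + d))"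
    using Suc.prems by (metis add_Suc less_imp_Suc_add)
  obtain p where p: "n = Suc p"
    using assms(1) by (cases n) auto
  \<comment> \<open>The absorption identity, with the subtraction taken in the reals so that it also
    covers p < m, where both sides vanish.\<close>
  have pascal: "real (Suc m) * real (p choose Suc m) = (real p - real m) * real (p choose m)"
  proof (cases "m \<le> p")
    case True
    have "Suc m * (p choose Suc m) = (p - m) * (p choose m)"
      by (metis binomial_absorb_comp binomial_absorption)
    then show ?thesis
      using True by (metis of_nat_diff of_nat_mult)
  qed (simp add: binomial_eq_0)
  have eq: "- real (p choose m) * fact m * fact (Suc d) +
      (real N - real n) * (real (p choose m) * fact m * fact d) =
      - real (p choose Suc m) * fact (Suc m) * fact d"
  proof -
    have "real (p choose Suc m) * fact (Suc m) * fact d =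
        (real (Suc m) * real (p choose Suc m)) * (fact m * fact d :: real)"
      by (simp only: fact_Suc ac_simps of_nat_mult)
    also have "\<dots> = (real p - real m) * real (p choose m) * (fact m * fact d :: real)"
      by (simp only: pascal)
    finally show ?thesis
      by (simp add: d p algebra_simps)
  qed
  have IH: "(real N - real n) * (\<Sum>j=1..m. conn N n j) =
      1 + - real (p choose m) * fact m * fact (Suc d) / fact (N - 1)"
    using Suc by (simp add: d p del: fact_Suc)
  have conn: "conn N n (Suc m) = real (p choose m) * fact m * fact d / fact (N - 1)"
    by (simp add: conn_def d p)
  have "(real N - real n) * (\<Sum>j=1..Suc m. conn N n j) =
      (real N - real n) * (\<Sum>j=1..m. conn N n j) + (real N - real n) * conn N n (Suc m)"
    by (simp add: distrib_left)
  also have "\<dots> = 1 + (- real (p choose m) * fact m * fact (Suc d) +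
      (real N - real n) * (real (p choose m) * fact m * fact d)) / fact (N - 1)"
    by (simp only: IH conn add_divide_distrib times_divide_eq_right add.assoc)
  also have "\<dots> = 1 - real (p choose Suc m) * fact (Suc m) * fact d / fact (N - 1)"
    unfolding eq by simp
  finally show ?case
    by (simp add: d p)
qed

text \<open>At m = N-1 the remainder of the telescoping sum contains binom(n-1,N-1), which is 0 as n
  < N.\<close>

lemma sum_conn_all:
  assumes "1 \<le> n" "n < N"
  shows "(real N - real n) * (\<Sum>m=1..<N. conn N n m) = 1"
proof -
  have "{1..<N} = {1..N - 1}"
    using assms by auto
  then show ?thesis
    using sum_conn_second[of n "N - 1" N] assms by (simp add: binomial_eq_0)
qed

text \<open>The hockey-stick identity sums binom(i-1,m-1) to binom(N-1,m) - binom(n-1,m). After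
  multiplication by m this is exactly the closed form found for the sum over the second
  argument.\<close>

lemma sum_conn_first:
  assumes "1 \<le> n" "n \<le> N" "1 \<le> m" "m < N"
  shows "(\<Sum>i=n..<N. conn N i m) = (real N - real n) * (\<Sum>j=1..m. conn N n j) / real m"
proof -
  obtain p where p: "m = Suc p"
    using assms(3) by (cases m) auto
  have "(\<Sum>i=n..<N. conn N i m) =
      (real ((N - 1) choose m) - real ((n - 1) choose m)) * fact p * fact (N - m - 1) / fact (N - 1)"
    using assms(2)
  \<comment> \<open>Downward induction from n = N, where both sides are 0; the step is Pascal's
    rule.\<close>
  proof (induction rule: inc_induct)
    case base
    then show ?case by simp
  next
    case (step i)
    obtain q where "i = Suc q"
      using step.hyps assms(1) by (cases i) auto
    then show ?case
      using step by (simp add: sum.atLeast_Suc_lessThan conn_def p field_simps)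
  qed
  also have "\<dots> = (real ((N - 1) choose m) * fact m * fact (N - m - 1) / fact (N - 1) -
      real ((n - 1) choose m) * fact m * fact (N - m - 1) / fact (N - 1)) / real m"
  proof -
    have "(a - b) * f * g / h = (a * (r * f) * g / h - b * (r * f) * g / h) / r"
      if "0 < r" for a b f g h r :: real
      using that by (simp add: algebra_simps diff_divide_distrib)
    moreover have "fact m = real m * fact p"
      by (simp add: p)
    ultimately show ?thesis
      using assms(3) by simp
  qed
  also have "real ((N - 1) choose m) * fact m * fact (N - m - 1) / fact (N - 1) = 1"
  proof -
    have "real (N - 1 choose m) = fact (N - 1) / (fact m * fact (N - 1 - m))"
      by (rule binomial_fact) (use assms in simp)
    moreover have "N - m - 1 = N - 1 - m"
      by simp
    ultimately show ?thesis
      by (simp only:) simp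
  qed
  finally show ?thesis
    unfolding sum_conn_second[OF assms(1,4)] .
qed

section \<open>Averaging and its eigenvectors\<close>

definition average :: "(nat \<Rightarrow> real) \<Rightarrow> nat \<Rightarrow> real" where
  "average g n = (\<Sum>i=1..n. g i) / real n"

text \<open>The sum of binom(i-1,m-1) over i from 1 to n is binom(n,m), and binom(n,m)/n =
  binom(n-1,m-1)/m.\<close>

lemma average_conn:
  assumes "1 \<le> n" "1 \<le> m"
  shows "average (\<lambda>i. conn N i m) n = conn N n m / real m"
proof -
  obtain p where p: "m = Suc p"
    using assms(2) by (cases m) auto
  obtain q where q: "n = Suc q"
    using assms(1) by (cases n) auto
  have "(\<Sum>i=1..n. real ((i - 1) choose p)) = real (n choose m)" for n
    by (induction n) (auto simp: p)
  then have "(\<Sum>i=1..n. real ((i - 1) choose p) * (fact p * fact (N - m - 1) / fact (N - 1))) =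
      real (n choose m) * (fact p * fact (N - m - 1) / fact (N - 1))"
    by (simp only: flip: sum_distrib_right)
  then have "average (\<lambda>i. conn N i m) n =
      real (n choose m) / real n * (fact p * fact (N - m - 1) / fact (N - 1))"
    by (simp add: average_def conn_def p ac_simps)
  also have "real (n choose m) / real n = real (q choose p) / real m"
    using Suc_times_binomial[of p q, THEN arg_cong, of real]
    by (simp add: p q divide_simps del: binomial_Suc_Suc) (simp add: algebra_simps)
  finally show ?thesis
    by (simp add: conn_def p q mult_ac)
qed

lemma average_cong:
  assumes "\<And>i. 1 \<le> i \<Longrightarrow> i \<le> n \<Longrightarrow> f i = g i"
  shows "average f n = average g n"
  unfolding average_def using assms by (auto intro!: arg_cong2[where f = "(/)"] sum.cong)

lemma average_sum:
  "average (\<lambda>i. \<Sum>m\<in>A. f m i * c m) n = (\<Sum>m\<in>A. average (f m) n * c m)"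
  unfolding average_def
  by (subst sum.swap) (simp add: sum_divide_distrib sum_distrib_right)

text \<open>In an expansion into eigenvectors each averaging divides the m-th coefficient by m. An
  expansion valid only for arguments from 1 to N-1 suffices, since the average at n sees only the
  values at 1, ..., n.\<close>

lemma average_power_conn:
  assumes "\<And>n. 1 \<le> n \<Longrightarrow> n < N \<Longrightarrow> g n = (\<Sum>m=1..<N. conn N n m * c m)" "1 \<le> n" "n < N"
  shows "(average ^^ j) g n = (\<Sum>m=1..<N. conn N n m * (c m / real m ^ j))"
  using assms(2,3)
proof (induction j arbitrary: n)
  case 0
  then show ?case using assms(1) by simp
next
  case (Suc j)
  have "(average ^^ Suc j) g n = average (\<lambda>i. \<Sum>m=1..<N. conn N i m * (c m / real m ^ j)) n"
    using Suc by (auto intro!: average_cong)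
  also have "\<dots> = (\<Sum>m=1..<N. average (\<lambda>i. conn N i m) n * (c m / real m ^ j))"
    by (rule average_sum)
  also have "\<dots> = (\<Sum>m=1..<N. conn N n m * (c m / real m ^ Suc j))"
    using Suc.prems by (intro sum.cong) (auto simp: average_conn)
  finally show ?case .
qed

section \<open>The two iterated sums\<close>

fun star_from :: "nat \<Rightarrow> nat list \<Rightarrow> nat \<Rightarrow> real" where
  "star_from N [] l = 1"
| "star_from N (k # ks) l = (\<Sum>m=l..<N. star_from N ks m / real m ^ k)"

text \<open>The outer variable \<open>n\<close> is the last entry of the first block. The averages
  descend from it to the first entry \<open>i\<close>, which carries the weight 1/(N-i) and bounds
  the last entry of the next block from below.\<close>

fun flat_from :: "nat \<Rightarrow> nat list \<Rightarrow> nat \<Rightarrow> real" where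
  "flat_from N [] l = 1"
| "flat_from N (k # ks) l =
    (\<Sum>n=l..<N. (average ^^ (k - 1)) (\<lambda>i. flat_from N ks i / (real N - real i)) n)"

section \<open>Comparison of the iterated sums through the connector\<close>

text \<open>Dividing the induction hypothesis by N-i leaves an expansion in connectors. The k-1
  averages contribute 1/m^(k-1), and the outer sum over i contributes the last 1/m while producing a
  sum over j \<le> m. Exchanging j and m rebuilds the star sum with lower bound j.\<close>

lemma flat_from_eq:
  assumes "is_index ks" "1 \<le> n" "n < N"
  shows "flat_from N ks n = (real N - real n) * (\<Sum>m=1..<N. conn N n m * star_from N ks m)"
  using assms
proof (induction ks arbitrary: n)
  case Nil
  then show ?case using sum_conn_all by simp
next
  case (Cons k ks)
  have k: "k = Suc (k - 1)" and ks: "is_index ks"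
    using Cons.prems by (auto simp: is_index_def)
  let ?c = "\<lambda>m. star_from N ks m / real m ^ (k - 1)"
  have "flat_from N ks i / (real N - real i) = (\<Sum>m=1..<N. conn N i m * star_from N ks m)"
    if "1 \<le> i" "i < N" for i
    using Cons.IH[OF ks that] that by simp
  then have "(average ^^ (k - 1)) (\<lambda>i. flat_from N ks i / (real N - real i)) i =
      (\<Sum>m=1..<N. conn N i m * ?c m)" if "n \<le> i" "i < N" for i
    using that Cons.prems by (intro average_power_conn) simp_all
  then have "flat_from N (k # ks) n = (\<Sum>i=n..<N. \<Sum>m=1..<N. conn N i m * ?c m)"
    by (auto intro!: sum.cong simp del: One_nat_def)
  also have "\<dots> = (\<Sum>m=1..<N. (\<Sum>i=n..<N. conn N i m) * ?c m)"
    by (subst sum.swap) (simp only: sum_distrib_right)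
  also have "\<dots> = (\<Sum>m=1..<N. \<Sum>j=1..m. (real N - real n) * (conn N n j * (star_from N ks m / real m ^ k)))"
    using Cons.prems
    by (intro sum.cong refl, subst k)
      (auto simp: sum_conn_first sum_distrib_left sum_distrib_right sum_divide_distrib ac_simps)
  \<comment> \<open>Both sides run over the triangle 1 \<le> j \<le> m < N.\<close>
  also have "\<dots> = (\<Sum>j=1..<N. \<Sum>m=j..<N. (real N - real n) * (conn N n j * (star_from N ks m / real m ^ k)))"
    unfolding sum.Sigma[OF finite_atLeastLessThan ballI, OF finite_atLeastAtMost]
      sum.Sigma[OF finite_atLeastLessThan ballI, OF finite_atLeastLessThan]
    by (rule sum.reindex_bij_witness[of _ prod.swap prod.swap]) auto
  also have "\<dots> = (real N - real n) * (\<Sum>j=1..<N. conn N n j * star_from N (k # ks) j)"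
    by (simp add: sum_distrib_left)
  finally show ?case .
qed

lemma flat_from_one:
  assumes "is_index ks"
  shows "flat_from N ks 1 = star_from N ks 1"
proof (cases "1 < N")
  case True
  \<comment> \<open>For n = 1 the binomial is binom(0,m-1), and at m = 1 the factorials leave
    (N-2)!/(N-1)!, which cancels the prefactor N-1.\<close>
  have "conn N 1 m = (if m = 1 then 1 / (real N - 1) else 0)" if "1 \<le> m" for m
  proof (cases "m = 1")
    case True
    then show ?thesis
      using \<open>1 < N\<close> fact_reduce[of "N - 1", where 'a = real] by (simp add: conn_def numeral_2_eq_2)
  qed (use that in \<open>simp add: conn_def\<close>)
  then have "(\<Sum>m=1..<N. conn N 1 m * star_from N ks m) =
      (\<Sum>m=1..<N. if m = 1 then star_from N ks m / (real N - 1) else 0)"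
    by (intro sum.cong) (auto simp del: One_nat_def)
  then have "flat_from N ks 1 =
      (real N - 1) * (\<Sum>m=1..<N. if m = 1 then star_from N ks m / (real N - 1) else 0)"
    by (subst flat_from_eq[OF assms]) (use True in simp_all)
  then show ?thesis
    using True by (simp add: sum.delta)
next
  case False
  \<comment> \<open>For N \<le> 1 both outer sums are empty, and for the empty index both values are
    1.\<close>
  then show ?thesis by (cases ks) auto
qed

section \<open>The star sum as an iterated sum\<close>

definition star_domain_from :: "nat \<Rightarrow> nat \<Rightarrow> nat list \<Rightarrow> nat list set" where
  "star_domain_from N l ks =
    {ms. length ms = length ks \<and> (\<forall>m\<in>set ms. l \<le> m \<and> m < N) \<and> sorted ms}"

lemma finite_star_domain_from: "finite (star_domain_from N l ks)"
  by (rule finite_subset[of _ "{ms. set ms \<subseteq> {..<N} \<and> length ms = length ks}"])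
    (auto simp: star_domain_from_def finite_lists_length_eq)

text \<open>Once the head \<open>m\<close> is split off, sortedness says precisely that the tail is
  a sorted list bounded below by \<open>m\<close>; hence the induction over a varying lower
  bound.\<close>

lemma sum_star_domain_from:
  "(\<Sum>ms\<in>star_domain_from N l ks. 1 / (\<Prod>i<length ks. real (ms ! i) ^ (ks ! i))) =
    star_from N ks l"
proof (induction ks arbitrary: l)
  case Nil
  have "star_domain_from N l [] = {[]}"
    by (auto simp: star_domain_from_def)
  then show ?case by simp
next
  case (Cons k ks)
  let ?w = "\<lambda>ks ms. 1 / (\<Prod>i<length ks. real (ms ! i) ^ (ks ! i))"
  have "(\<Sum>ms\<in>star_domain_from N l (k # ks). ?w (k # ks) ms) =
      (\<Sum>(m, ms)\<in>Sigma {l..<N} (\<lambda>m. star_domain_from N m ks). ?w ks ms / real m ^ k)"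
    by (rule sum.reindex_bij_witness[of _ "\<lambda>(m, ms). m # ms" "\<lambda>ms. (hd ms, tl ms)"])
      (auto simp: star_domain_from_def length_Suc_conv prod.lessThan_Suc_shift simp del: prod.lessThan_Suc)
  also have "\<dots> = (\<Sum>m=l..<N. \<Sum>ms\<in>star_domain_from N m ks. ?w ks ms / real m ^ k)"
    by (rule sum.Sigma[symmetric]) (auto simp: finite_star_domain_from)
  also have "\<dots> = star_from N (k # ks) l"
    by (simp only: Cons.IH star_from.simps flip: sum_divide_distrib)
  finally show ?case .
qed

section \<open>Sums over one block\<close>

lemma sorted_le_last:
  fixes x :: "'a :: linorder"
  assumes "sorted xs" "x \<in> set xs"
  shows "x \<le> last xs"
  using assms by (induction xs) (auto split: if_splits)

text \<open>The parameter \<open>k\<close> counts the averages, so the length is one more. Fixing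
  the last entry bounds all the others from above.\<close>

definition block :: "nat \<Rightarrow> nat \<Rightarrow> nat list set" where
  "block k n = {ns. length ns = Suc k \<and> (\<forall>i\<in>set ns. 0 < i) \<and> sorted ns \<and> last ns = n}"

lemma finite_block: "finite (block k n)"
proof (rule finite_subset)
  show "block k n \<subseteq> {ns. set ns \<subseteq> {..n} \<and> length ns = Suc k}"
    by (auto simp: block_def sorted_le_last)
qed (simp add: finite_lists_length_eq)

text \<open>Removing the last entry \<open>n\<close> takes out the factor 1/n and leaves a shorter
  block whose last entry \<open>i\<close> runs from 1 to \<open>n\<close>, which is one outer
  averaging. Only the first entry has no reciprocal weight; it is the argument of
  \<open>g\<close>.\<close>

lemma sum_block:
  assumes "0 < n"
  shows "(\<Sum>ns\<in>block k n. g (ns ! 0) / (\<Prod>j=1..<Suc k. real (ns ! j))) = (average ^^ k) g n"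
  using assms
proof (induction k arbitrary: n)
  case 0
  then have "block 0 n = {[n]}"
    by (auto simp: block_def length_Suc_conv)
  then show ?case by simp
next
  case (Suc k)
  let ?w = "\<lambda>k ns. g (ns ! 0) / (\<Prod>j=1..<Suc k. real (ns ! j))"
  have prod_snoc: "(\<Prod>j=1..<Suc k. real ((ns @ [n]) ! j)) = (\<Prod>j=1..<Suc k. real (ns ! j))"
    if "length ns = Suc k" for ns :: "nat list"
    using that by (intro prod.cong) (auto simp: nth_append)
  have "(\<Sum>ns\<in>block (Suc k) n. ?w (Suc k) ns) =
      (\<Sum>(i, ns)\<in>Sigma {1..n} (block k). ?w k ns / real n)"
  proof (rule sum.reindex_bij_witness
      [of _ "\<lambda>(i, ns). ns @ [n]" "\<lambda>ns. (last (butlast ns), butlast ns)"])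
    fix ns assume "ns \<in> block (Suc k) n"
    then obtain ms where ms: "ns = ms @ [n]" "length ms = Suc k" "sorted ms"
      "\<forall>i\<in>set ms. 0 < i" "\<forall>i\<in>set ms. i \<le> n"
      by (cases ns rule: rev_cases) (auto simp: block_def sorted_append)
    \<comment> \<open>Since \<open>ms\<close> is nonempty, the bounds on its entries put its last
      entry between 1 and \<open>n\<close>.\<close>
    then have "last ms \<in> set ms"
      by (auto intro!: last_in_set)
    then show "(last (butlast ns), butlast ns) \<in> Sigma {1..n} (block k)"
      using ms by (auto simp: block_def)
    show "(case (last (butlast ns), butlast ns) of (i, ns) \<Rightarrow> ns @ [n]) = ns"
      using ms by simp
    show "(case (last (butlast ns), butlast ns) of (i, ns) \<Rightarrow> ?w k ns / real n) = ?w (Suc k) ns"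
      using ms prod_snoc[OF ms(2)] nth_append_length[of ms n "[]"]
      by (simp add: nth_append)
  next
    fix p assume "p \<in> Sigma {1..n} (block k)"
    then obtain i ns where p: "p = (i, ns)" "1 \<le> i" "i \<le> n" "ns \<in> block k i"
      by auto
    then show "(case p of (i, ns) \<Rightarrow> ns @ [n]) \<in> block (Suc k) n"
      using Suc.prems sorted_le_last by (fastforce simp: block_def sorted_append)
    show "(last (butlast (case p of (i, ns) \<Rightarrow> ns @ [n])), butlast (case p of (i, ns) \<Rightarrow> ns @ [n])) = p"
      using p by (simp add: block_def)
  qed
  also have "\<dots> = (\<Sum>i=1..n. \<Sum>ns\<in>block k i. ?w k ns / real n)"
    by (rule sum.Sigma[symmetric]) (auto simp: finite_block)
  also have "\<dots> = (\<Sum>i=1..n. (average ^^ k) g i / real n)"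
    by (intro sum.cong refl, subst sum_divide_distrib[symmetric], subst Suc.IH) auto
  also have "\<dots> = (average ^^ Suc k) g n"
    by (simp add: average_def sum_divide_distrib)
  finally show ?case .
qed

section \<open>The flat sum as an iterated sum\<close>

text \<open>The bound falls on the last entry of the first block because this is the entry that the
  linking condition compares with the preceding block. The empty index has no such entry.\<close>

definition flat_domain_from :: "nat \<Rightarrow> nat \<Rightarrow> nat list \<Rightarrow> nat list list set" where
  "flat_domain_from N l ks = {nss \<in> star_flat_domain N ks. ks \<noteq> [] \<longrightarrow> l \<le> last (hd nss)}"

text \<open>The linking condition between the first two blocks turns into a lower bound on the
  remaining blocks, so these depend on \<open>ns\<close> only through \<open>ns ! 0\<close>.
  Positivity of the index keeps the blocks nonempty, so that \<open>last\<close> is the entry at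
  position k-1.\<close>

lemma star_flat_domain_Cons:
  assumes "is_index (k # ks)"
  shows "ns # nss \<in> star_flat_domain N (k # ks) \<longleftrightarrow>
    ns \<in> block (k - 1) (last ns) \<and> last ns < N \<and> nss \<in> flat_domain_from N (ns ! 0) ks"
proof -
  have block: "ns \<in> block (k - 1) (last ns) \<and> last ns < N \<longleftrightarrow>
      length ns = k \<and> (\<forall>n\<in>set ns. 0 < n \<and> n < N) \<and> sorted ns"
  proof -
    have "0 < k" using assms by (simp add: is_index_def)
    moreover have "last ns < N \<longleftrightarrow> (\<forall>n\<in>set ns. n < N)" if "sorted ns" "ns \<noteq> []"
      using sorted_le_last[OF that(1)] last_in_set[OF that(2)] by (meson le_less_trans)
    ultimately show ?thesis
      by (cases "ns = []") (auto simp: block_def)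
  qed
  have all_Suc: "(\<forall>i<Suc n. P i) \<longleftrightarrow> P 0 \<and> (\<forall>i<n. P (Suc i))" for P and n :: nat
    by (auto simp: less_Suc_eq_0_disj)
  \<comment> \<open>The condition at i = 1 is separated; those with i \<ge> 2 shift down to the
    conditions for the tail.\<close>
  have link: "(\<forall>i. 1 \<le> i \<and> i < length (k # ks) \<longrightarrow>
        (ns # nss) ! (i - 1) ! 0 \<le> (ns # nss) ! i ! ((k # ks) ! i - 1)) \<longleftrightarrow>
      (ks \<noteq> [] \<longrightarrow> ns ! 0 \<le> last (hd nss)) \<and>
      (\<forall>i. 1 \<le> i \<and> i < length ks \<longrightarrow> nss ! (i - 1) ! 0 \<le> nss ! i ! (ks ! i - 1))"
    if len: "length nss = length ks" "\<forall>i<length ks. length (nss ! i) = ks ! i"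
  proof (cases ks)
    case (Cons k' ks')
    then obtain ms mss where nss: "nss = ms # mss" "length ms = k'" "length mss = length ks'"
      using len by (cases nss) auto
    moreover have "ms \<noteq> []"
      using assms nss Cons by (auto simp: is_index_def)
    moreover have "(\<forall>i. 1 \<le> i \<and> i < Suc n \<longrightarrow> P i) \<longleftrightarrow> (\<forall>i<n. P (Suc i))" for P and n :: nat
      by (auto simp: gr0_conv_Suc Suc_le_eq)
    ultimately show ?thesis
      using Cons by (simp add: all_Suc last_conv_nth hd_conv_nth)
  qed simp
  show ?thesis
    unfolding flat_domain_from_def star_flat_domain_def
    using block link by (auto simp: all_Suc)
qed

lemma finite_flat_domain_from: "finite (flat_domain_from N l ks)"
  by (simp add: flat_domain_from_def finite_star_flat_domain)

text \<open>The first block is split off and the sum ordered by its last entry, the block, and the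
  rest. The induction hypothesis with lower bound \<open>ns ! 0\<close> evaluates the sum over the
  rest; \<open>sum_block\<close> then turns the sum over the block into averages.\<close>

lemma sum_flat_domain_from:
  assumes "is_index ks" "1 \<le> l"
  shows "(\<Sum>nss\<in>flat_domain_from N l ks. \<Prod>i<length ks.
      1 / ((real N - real (nss ! i ! 0)) * (\<Prod>j=1..<ks ! i. real (nss ! i ! j)))) =
    flat_from N ks l"
  using assms
proof (induction ks arbitrary: l)
  case Nil
  have "flat_domain_from N l [] = {[]}"
    by (auto simp: flat_domain_from_def star_flat_domain_def)
  then show ?case by simp
next
  case (Cons k ks)
  let ?w = "\<lambda>ks nss. \<Prod>i<length ks.
    1 / ((real N - real (nss ! i ! 0)) * (\<Prod>j=1..<ks ! i. real (nss ! i ! j)))"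
  let ?v = "\<lambda>ns. 1 / ((real N - real (ns ! 0)) * (\<Prod>j=1..<k. real (ns ! j)))"
  have k: "Suc (k - 1) = k" and ks: "is_index ks"
    using Cons.prems by (auto simp: is_index_def)
  \<comment> \<open>The new lower bound is at least 1, as the induction hypothesis demands.\<close>
  have pos: "1 \<le> ns ! 0" if "ns \<in> block (k - 1) n" for ns n
    using that nth_mem[of 0 ns] by (auto simp: block_def Suc_le_eq)
  have "(\<Sum>nss\<in>flat_domain_from N l (k # ks). ?w (k # ks) nss) =
      (\<Sum>((n, ns), nss)\<in>Sigma (Sigma {l..<N} (block (k - 1))) (\<lambda>(n, ns). flat_domain_from N (ns ! 0) ks).
        ?v ns * ?w ks nss)"
  proof (rule sum.reindex_bij_witness[of _ "\<lambda>((n, ns), nss). ns # nss"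
        "\<lambda>nss. ((last (hd nss), hd nss), tl nss)"])
    fix nss assume A: "nss \<in> flat_domain_from N l (k # ks)"
    then obtain ns nss' where nss: "nss = ns # nss'"
      by (cases nss) (auto simp: flat_domain_from_def star_flat_domain_def)
    show "((last (hd nss), hd nss), tl nss) \<in>
        Sigma (Sigma {l..<N} (block (k - 1))) (\<lambda>(n, ns). flat_domain_from N (ns ! 0) ks)"
      using A star_flat_domain_Cons[OF Cons.prems(1)] by (auto simp: nss flat_domain_from_def)
    show "(\<lambda>((n, ns), nss). ns # nss) ((last (hd nss), hd nss), tl nss) = nss"
      by (simp add: nss)
    show "(\<lambda>((n, ns), nss). ?v ns * ?w ks nss) ((last (hd nss), hd nss), tl nss) =
        ?w (k # ks) nss"
      by (simp add: nss prod.lessThan_Suc_shift del: prod.lessThan_Suc)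
  next
    fix p assume A: "p \<in> Sigma (Sigma {l..<N} (block (k - 1))) (\<lambda>(n, ns). flat_domain_from N (ns ! 0) ks)"
    then obtain n ns nss where p: "p = ((n, ns), nss)" by (metis surj_pair)
    have n: "last ns = n"
      using A p by (auto simp: block_def)
    show "((\<lambda>((n, ns), nss). ns # nss) p) \<in> flat_domain_from N l (k # ks)"
      using A star_flat_domain_Cons[OF Cons.prems(1), of ns nss N]
      by (simp add: p n flat_domain_from_def)
    show "((last (hd ((\<lambda>((n, ns), nss). ns # nss) p)), hd ((\<lambda>((n, ns), nss). ns # nss) p)),
        tl ((\<lambda>((n, ns), nss). ns # nss) p)) = p"
      using n by (simp add: p)
  qed
  also have "\<dots> = (\<Sum>(n, ns)\<in>Sigma {l..<N} (block (k - 1)).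
      \<Sum>nss\<in>flat_domain_from N (ns ! 0) ks. ?v ns * ?w ks nss)"
    by (subst sum.Sigma[symmetric]) (auto simp: finite_flat_domain_from finite_block split_def)
  also have "\<dots> = (\<Sum>n=l..<N. \<Sum>ns\<in>block (k - 1) n.
      \<Sum>nss\<in>flat_domain_from N (ns ! 0) ks. ?v ns * ?w ks nss)"
    by (rule sum.Sigma[symmetric]) (auto simp: finite_block)
  also have "\<dots> = (\<Sum>n=l..<N. \<Sum>ns\<in>block (k - 1) n.
      flat_from N ks (ns ! 0) / (real N - real (ns ! 0)) / (\<Prod>j=1..<Suc (k - 1). real (ns ! j)))"
  proof (intro sum.cong refl)
    fix n ns assume "ns \<in> block (k - 1) n"
    then show "(\<Sum>nss\<in>flat_domain_from N (ns ! 0) ks. ?v ns * ?w ks nss) =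
        flat_from N ks (ns ! 0) / (real N - real (ns ! 0)) / (\<Prod>j=1..<Suc (k - 1). real (ns ! j))"
      by (simp only: Cons.IH[OF ks pos] k flip: sum_distrib_left) simp
  qed
  also have "\<dots> = flat_from N (k # ks) l"
    \<comment> \<open>Here \<open>g\<close> in \<open>sum_block\<close> is the function sending i to
      \<open>flat_from N ks i / (real N - real i)\<close>.\<close>
    unfolding flat_from.simps
    by (intro sum.cong refl sum_block) (use Cons.prems(2) in auto)
  finally show ?case .
qed

theorem theorem2p1:
  fixes ks :: "nat list" and N :: nat
  assumes "is_index ks" and "0 < N"
  shows "zeta_star N ks = zeta_star_flat N ks"
proof -
  have "star_domain N ks = star_domain_from N 1 ks"
    by (auto simp: star_domain_def star_domain_from_def Suc_le_eq)
  then have star: "zeta_star N ks = star_from N ks 1"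
    by (simp only: zeta_star_def sum_star_domain_from)
  \<comment> \<open>All entries are positive, so the lower bound 1 cuts nothing from the flat
    domain.\<close>
  have "1 \<le> last (hd nss)" if nss: "nss \<in> star_flat_domain N ks" "ks \<noteq> []" for nss
  proof -
    obtain k ks' ns nss' where "ks = k # ks'" "nss = ns # nss'"
      using nss by (cases ks; cases nss) (auto simp: star_flat_domain_def)
    then have "ns \<in> block (k - 1) (last ns)"
      using star_flat_domain_Cons[of k ks' ns nss' N] assms nss by simp
    then show ?thesis
      using last_in_set[of ns] \<open>nss = _\<close> by (cases ns) (auto simp: block_def Suc_le_eq)
  qed
  then have "star_flat_domain N ks = flat_domain_from N 1 ks"
    by (auto simp: flat_domain_from_def)
  then have "zeta_star_flat N ks = flat_from N ks 1"
    using sum_flat_domain_from[OF assms(1), of 1 N] by (simp add: zeta_star_flat_def)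
  then show ?thesis
    using star flat_from_one[OF assms(1)] by simp
qed

end
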